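(* Assume the dataset $\mathcal{D}$ is sampled from a distribution $\pi(\mathcal{D})$, and let the outcome of training on a sampled dataset $\mathcal{D}$ be described by a distribution $Q(w|\mathcal{D})$ on weights $w$. Then the pre-distribution $P(w)$ minimizing the expected complexity $\mathbb{E}_{\mathcal{D}}[C_\beta(\mathcal{D};P,Q)]$ is $P(w)=\mathbb{E}_{\mathcal{D}}[Q(w|\mathcal{D})]$, and (for this $P$) the expected information in the weights is \[ \mathbb{E}_{\mathcal{D}}\bigl[\mathrm{KL}(Q(w|\mathcal{D})\,\|\,P(w))\bigr]=I(w;\mathcal{D}), \] where $I(w;\mathcal{D})$ is Shannon's mutual information between the weights and the dataset, the weights being seen as the stochastic function of the dataset given by $\mathcal{D}\mapsto Q(w|\mathcal{D})$.
   Context: A dataset is a finite collection $\mathcal{D}=\{(x_i,y_i)\}_{i=1}^N$ of inputs and discrete labels, and $p_w(y|x)$ is a fixed class of conditional distributions parametrized by a weight vector $w$. Let $L_{\mathcal{D}}(p)=\sum_{i=1}^N-\log p(y_i|x_i)$. For a pre-distribution $P(w)$ (chosen independently of the data), a post-distribution $Q(w|\mathcal{D})$, and a parameter $\beta>0$, the complexity at level $\beta$ is \[ C_\beta(\mathcal{D};P,Q)=\mathbb{E}_{w\sim Q(w|\mathcal{D})}[L_{\mathcal{D}}(p_w(y|x))]+\beta\,\mathrm{KL}(Q(w|\mathcal{D})\,\|\,P(w)), \] and the second factor $\mathrm{KL}(Q(w|\mathcal{D})\,\|\,P(w))$ is called the information in the weights. $\mathbb{E}_{\mathcal{D}}$ denotes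 expectation over $\mathcal{D}\sim\pi$, and the minimization is over all probability distributions $P(w)$ with $Q$ fixed. *)

theory Defs
  imports "HOL-Probability.Probability"
begin

text \<open>
  All losses and divergences take values in \<^typ>\<open>ennreal\<close>, logarithms are natural.  Labels are
  discrete, so \<open>p(y|x) \<le> 1\<close> and the log-loss is nonnegative.
\<close>

text \<open>The value \<open>\<infinity>\<close> at \<open>0\<close> is needed because \<^prop>\<open>ln (0::real) = 0\<close>.\<close>

definition neg_ln :: "real \<Rightarrow> ennreal" where
  "neg_ln q = (if q \<le> 0 then \<infinity> else ennreal (- ln q))"

text \<open>A dataset is the list of its labelled examples; a conditional distribution \<open>p(y|x)\<close> is a
  function into \<^typ>\<open>'y pmf\<close>.\<close>

definition loss :: "('x \<times> 'y) list \<Rightarrow> ('x \<Rightarrow> 'y pmf) \<Rightarrow> ennreal" where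
  "loss D p = (\<Sum>(x, y)\<leftarrow>D. neg_ln (pmf (p x) y))"

text \<open>
  Kullback-Leibler divergence of probability measures in the usual order, \<open>KL(Q \<parallel> P)\<close>.
  The library's \<^const>\<open>KL_divergence\<close> takes the reference measure first and is real-valued: it is
  only meaningful if \<open>Q\<close> is absolutely continuous w.r.t. \<open>P\<close> and \<open>log(dQ/dP)\<close> is
  \<open>Q\<close>-integrable.  The negative part of \<open>log(dQ/dP)\<close> is always \<open>Q\<close>-integrable, so non-integrability
  means that the divergence is \<open>\<infinity>\<close>.
\<close>

definition KL :: "'a measure \<Rightarrow> 'a measure \<Rightarrow> ennreal" where
  "KL Q P =
    (if absolutely_continuous P Q \<and> integrable Q (entropy_density (exp 1) P Q)
     then ennreal (KL_divergence (exp 1) P Q) else \<infinity>)"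

text \<open>The extended-valued counterpart of the library's \<^const>\<open>prob_space.mutual_information\<close>.\<close>

definition mutual_info ::
  "'a measure \<Rightarrow> 'b measure \<Rightarrow> 'c measure \<Rightarrow> ('a \<Rightarrow> 'b) \<Rightarrow> ('a \<Rightarrow> 'c) \<Rightarrow> ennreal" where
  "mutual_info M S T X Y =
    KL (distr M (S \<Otimes>\<^sub>M T) (\<lambda>x. (X x, Y x))) (distr M S X \<Otimes>\<^sub>M distr M T Y)"

lemma (in prob_space) mutual_info_eq_mutual_information:
  assumes "mutual_info M S T X Y < \<infinity>"
  shows "mutual_info M S T X Y = ennreal (mutual_information (exp 1) S T X Y)"
  using assms unfolding mutual_info_def KL_def mutual_information_def
  by (auto split: if_splits)

text \<open>In the following, \<open>Q D\<close> is the post-distribution \<open>Q(w|D)\<close> and \<open>p w\<close> is \<open>p\<^sub>w(y|x)\<close>.\<close>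

definition info_in_weights ::
  "('x \<times> 'y) list \<Rightarrow> 'w measure \<Rightarrow> (('x \<times> 'y) list \<Rightarrow> 'w measure) \<Rightarrow> ennreal" where
  "info_in_weights D P Q = KL (Q D) P"

definition complexity ::
  "('w \<Rightarrow> 'x \<Rightarrow> 'y pmf) \<Rightarrow> real \<Rightarrow> ('x \<times> 'y) list \<Rightarrow> 'w measure
    \<Rightarrow> (('x \<times> 'y) list \<Rightarrow> 'w measure) \<Rightarrow> ennreal" where
  "complexity p \<beta> D P Q = (\<integral>\<^sup>+ w. loss D (p w) \<partial>Q D) + ennreal \<beta> * info_in_weights D P Q"

definition expected_complexity ::
  "('w \<Rightarrow> 'x \<Rightarrow> 'y pmf) \<Rightarrow> real \<Rightarrow> ('x \<times> 'y) list measure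
    \<Rightarrow> (('x \<times> 'y) list \<Rightarrow> 'w measure) \<Rightarrow> 'w measure \<Rightarrow> ennreal" where
  "expected_complexity p \<beta> \<pi> Q P = (\<integral>\<^sup>+ D. complexity p \<beta> D P Q \<partial>\<pi>)"

text \<open>The joint law of \<open>(D, w)\<close> when the dataset is sampled from \<open>\<pi>\<close> and then the weights from
  \<open>Q(w|D)\<close>.\<close>

definition joint :: "'d measure \<Rightarrow> 'w measure \<Rightarrow> ('d \<Rightarrow> 'w measure) \<Rightarrow> ('d \<times> 'w) measure" where
  "joint \<pi> W Q = do {D \<leftarrow> \<pi>; w \<leftarrow> Q D; return (\<pi> \<Otimes>\<^sub>M W) (D, w)}"

text \<open>The marginals of the joint law; the second one is the mixture \<open>E\<^sub>D[Q(w|D)]\<close>.\<close>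

lemma
  assumes "prob_space \<pi>" and Q: "Q \<in> \<pi> \<rightarrow>\<^sub>M prob_algebra W"
  shows distr_joint_fst: "distr (joint \<pi> W Q) \<pi> fst = \<pi>"
    and distr_joint_snd: "distr (joint \<pi> W Q) W snd = \<pi> \<bind> Q"
    and emeasure_mixture: "A \<in> sets W \<Longrightarrow> emeasure (\<pi> \<bind> Q) A = (\<integral>\<^sup>+ D. emeasure (Q D) A \<partial>\<pi>)"
proof -
  interpret prob_space \<pi> by fact
  have Q'[measurable]: "Q \<in> \<pi> \<rightarrow>\<^sub>M subprob_algebra W"
    by (rule measurable_prob_algebraD[OF Q])
  have setsQ: "sets (Q D) = sets W" if "D \<in> space \<pi>" for D
    using Q' that by (rule sets_kernel)
  have probQ: "prob_space (Q D)" if "D \<in> space \<pi>" for D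
    using measurable_space[OF Q that] by (simp add: space_prob_algebra)
  have ret: "return (\<pi> \<Otimes>\<^sub>M W) \<in> (\<pi> \<Otimes>\<^sub>M W) \<rightarrow>\<^sub>M subprob_algebra (\<pi> \<Otimes>\<^sub>M W)"
    by (rule return_measurable)
  have inner: "(\<lambda>D. Q D \<bind> (\<lambda>w. return (\<pi> \<Otimes>\<^sub>M W) (D, w))) \<in> \<pi> \<rightarrow>\<^sub>M subprob_algebra (\<pi> \<Otimes>\<^sub>M W)"
    by (rule measurable_bind'[OF Q']) (simp add: ret)
  have dist: "distr (joint \<pi> W Q) N f = \<pi> \<bind> (\<lambda>D. Q D \<bind> (\<lambda>w. return N (f (D, w))))"
    if f[measurable]: "f \<in> (\<pi> \<Otimes>\<^sub>M W) \<rightarrow>\<^sub>M N" for f and N :: "'c measure"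
  proof -
    have "distr (joint \<pi> W Q) N f
        = \<pi> \<bind> (\<lambda>D. distr (Q D \<bind> (\<lambda>w. return (\<pi> \<Otimes>\<^sub>M W) (D, w))) N f)"
      unfolding joint_def by (rule distr_bind[OF inner not_empty f])
    also have "\<dots> = \<pi> \<bind> (\<lambda>D. Q D \<bind> (\<lambda>w. return N (f (D, w))))"
    proof (rule bind_cong[OF refl])
      fix D assume D: "D \<in> space \<pi>"
      have W: "space W \<noteq> {}" "space (Q D) = space W"
        using prob_space.not_empty[OF probQ[OF D]] sets_eq_imp_space_eq[OF setsQ[OF D]] by auto
      have "distr (Q D \<bind> (\<lambda>w. return (\<pi> \<Otimes>\<^sub>M W) (D, w))) N f
          = Q D \<bind> (\<lambda>w. distr (return (\<pi> \<Otimes>\<^sub>M W) (D, w)) N f)"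
        using D W by (intro distr_bind[where K="\<pi> \<Otimes>\<^sub>M W"])
          (auto simp: measurable_cong_sets[OF setsQ[OF D] refl])
      also have "\<dots> = Q D \<bind> (\<lambda>w. return N (f (D, w)))"
        using D W by (intro bind_cong refl distr_return) (auto simp: space_pair_measure)
      finally show "distr (Q D \<bind> (\<lambda>w. return (\<pi> \<Otimes>\<^sub>M W) (D, w))) N f = \<dots>" .
    qed
    finally show ?thesis .
  qed
  have "distr (joint \<pi> W Q) \<pi> fst = \<pi> \<bind> (\<lambda>D. return \<pi> D)"
    unfolding dist[OF measurable_fst]
  proof (rule bind_cong[OF refl])
    fix D assume D: "D \<in> space \<pi>"
    interpret Q: prob_space "Q D" by (rule probQ[OF D])
    show "Q D \<bind> (\<lambda>w. return \<pi> (fst (D, w))) = return \<pi> D"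
      using D by (simp add: bind_const' subprob_space_return Q.prob_space_axioms)
  qed
  then show "distr (joint \<pi> W Q) \<pi> fst = \<pi>"
    by (simp add: bind_return'')
  show "distr (joint \<pi> W Q) W snd = \<pi> \<bind> Q"
    unfolding dist[OF measurable_snd] snd_conv
    by (rule bind_cong[OF refl]) (simp add: bind_return'' setsQ)
  show "A \<in> sets W \<Longrightarrow> emeasure (\<pi> \<bind> Q) A = (\<integral>\<^sup>+ D. emeasure (Q D) A \<partial>\<pi>)"
    by (rule emeasure_bind[OF not_empty Q'])
qed

end

theory Submission
  imports Defs
begin

text \<open>
  Let \<open>J\<close> (the constant \<open>law\<close>) be the law of \<open>(w, D)\<close> and \<open>M\<close> the mixture of the \<open>Q D\<close>, that is, the \<open>w\<close>-marginal of \<open>J\<close>.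
  For every \<open>P\<close>, disintegrating the density of \<open>J\<close> with respect to \<open>P \<otimes> \<pi>\<close> gives
  \<open>E\<^sub>D[KL(Q D \<parallel> P)] = KL(J \<parallel> P \<otimes> \<pi>)\<close>; for \<open>P = M\<close> the right-hand side is the mutual information.
  The chain rule \<open>KL(J \<parallel> P \<otimes> \<pi>) = KL(J \<parallel> M \<otimes> \<pi>) + KL(M \<parallel> P)\<close> then shows that \<open>M\<close> is a minimizer, and
  the only one as soon as the minimum is finite.
\<close>

section \<open>Divergence as the integral of a nonnegative function of the density\<close>

text \<open>This is the tangent-line bound \<open>ln t \<le> t - 1\<close> at
  \<open>t = 1 / x\<close>, multiplied by \<open>x\<close>. At \<open>x = 0\<close> the convention
  \<open>ln 0 = 0\<close> gives the value 1.\<close>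

lemma xlnx_minus_self_plus_1_nonneg: "0 \<le> (x::real) \<Longrightarrow> 0 \<le> x * ln x - x + 1"
proof (cases "x = 0")
  case False
  assume "0 \<le> x"
  with False have x: "0 < x" by simp
  then have "ln (1 / x) \<le> 1 / x - 1"
    by (intro ln_le_minus_one) simp
  then have "x * ln (1 / x) \<le> x * (1 / x - 1)"
    using x by (intro mult_left_mono) auto
  with x show ?thesis
    by (simp add: ln_div algebra_simps)
qed simp

text \<open>Against \<open>M\<close> the integrand becomes \<open>g * max 0 (- ln g)\<close>, and
  the tangent-line bound gives \<open>- t * ln t \<le> 1 - t \<le> 1\<close> for
  \<open>t \<ge> 0\<close>. A bounded function is integrable over a probability space.\<close>

lemma (in prob_space) integrable_density_ln_neg:
  fixes g :: "'a \<Rightarrow> real"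
  assumes [measurable]: "g \<in> borel_measurable M" and nn: "\<And>x. 0 \<le> g x"
  shows "integrable (density M g) (\<lambda>x. max 0 (- ln (g x)))"
proof (subst integrable_density)
  show "integrable M (\<lambda>x. g x *\<^sub>R max 0 (- ln (g x)))"
  proof (rule integrable_const_bound[where B=1])
    show "AE x in M. norm (g x *\<^sub>R max 0 (- ln (g x))) \<le> 1"
    proof (rule AE_I2)
      fix x
      show "norm (g x *\<^sub>R max 0 (- ln (g x))) \<le> 1"
        using xlnx_minus_self_plus_1_nonneg[OF nn[of x]] nn[of x]
        by (cases "ln (g x) \<le> 0") (auto simp: max_def abs_mult)
    qed
  qed simp
qed (auto simp: nn)

text \<open>The Radon-Nikodym derivative agrees with \<open>g\<close> up to an \<open>M\<close>-null
  set, which is also null for \<open>density M g\<close>. Hence a chosen density may replace it in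
  the divergence.\<close>

lemma (in prob_space) KL_density_ln:
  fixes g :: "'a \<Rightarrow> real"
  assumes [measurable]: "g \<in> borel_measurable M" and nn: "\<And>x. 0 \<le> g x"
  shows "KL (density M g) M =
    (if integrable (density M g) (\<lambda>x. ln (g x))
     then ennreal (\<integral>x. ln (g x) \<partial>density M g) else \<infinity>)"
proof -
  have ac: "absolutely_continuous M (density M g)"
    by (rule absolutely_continuousI_density) simp
  have "AE x in M. ennreal (g x) = RN_deriv M (density M g) x"
    by (rule RN_deriv_unique) auto
  then have "AE x in density M g. ennreal (g x) = RN_deriv M (density M g) x"
    by (rule absolutely_continuous_AE[OF _ ac, rotated]) simp
  then have AE: "AE x in density M g. entropy_density (exp 1) M (density M g) x = ln (g x)"
  proof eventually_elim
    case (elim x)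
    then have "enn2real (RN_deriv M (density M g) x) = g x"
      by (metis enn2real_ennreal nn)
    then show ?case
      by (simp add: entropy_density_def log_def)
  qed
  have meas: "entropy_density (exp 1) M (density M g) \<in> borel_measurable (density M g)"
    by simp
  have "integrable (density M g) (entropy_density (exp 1) M (density M g)) \<longleftrightarrow>
      integrable (density M g) (\<lambda>x. ln (g x))"
    using meas AE by (intro integrable_cong_AE) auto
  moreover have "KL_divergence (exp 1) M (density M g) = (\<integral>x. ln (g x) \<partial>density M g)"
    unfolding KL_divergence_def using meas AE by (intro integral_cong_AE) auto
  ultimately show ?thesis
    using ac by (simp add: KL_def)
qed

text \<open>Both \<open>g\<close> and the constant 1 have integral 1, so adding \<open>1 - g\<close>
  to \<open>g * ln g\<close> changes neither integrability nor the integral, while it makes the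
  integrand nonnegative.\<close>

lemma (in prob_space) integral_ln_density:
  fixes g :: "'a \<Rightarrow> real"
  assumes [measurable]: "g \<in> borel_measurable M" and nn: "\<And>x. 0 \<le> g x"
    and "prob_space (density M g)"
  shows "integrable (density M g) (\<lambda>x. ln (g x)) \<longleftrightarrow>
      integrable M (\<lambda>x. g x * ln (g x) - g x + 1)" (is "?A \<longleftrightarrow> ?B")
    and "integrable (density M g) (\<lambda>x. ln (g x)) \<Longrightarrow>
      (\<integral>x. ln (g x) \<partial>density M g) = (\<integral>x. g x * ln (g x) - g x + 1 \<partial>M)"
proof -
  interpret N: prob_space "density M g" by fact
  have g1: "(\<integral>\<^sup>+x. ennreal (g x) \<partial>M) = 1"
    using N.emeasure_space_1 by (simp add: emeasure_density cong: nn_integral_cong)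
  then have g: "integrable M g"
    by (intro integrableI_nonneg) (auto simp: nn)
  have intg: "integral\<^sup>L M g = 1"
    using g1 by (subst integral_eq_nn_integral) (auto simp: nn)
  have *: "?A \<longleftrightarrow> integrable M (\<lambda>x. g x * ln (g x))"
    by (subst integrable_density) (auto simp: nn)
  show "?A \<longleftrightarrow> ?B"
  proof
    assume ?A
    with * have "integrable M (\<lambda>x. g x * ln (g x))" by simp
    with g show ?B
      by simp
  next
    assume ?B
    moreover have "integrable M (\<lambda>x. g x - 1)"
      using g by simp
    ultimately have "integrable M (\<lambda>x. (g x * ln (g x) - g x + 1) + (g x - 1))"
      by (rule Bochner_Integration.integrable_add)
    moreover have "(\<lambda>x. (g x * ln (g x) - g x + 1) + (g x - 1)) = (\<lambda>x. g x * ln (g x))"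
      by auto
    ultimately show ?A unfolding * by (simp only:)
  qed
  assume ?A
  with * have "integrable M (\<lambda>x. g x * ln (g x))" by simp
  with g intg have "(\<integral>x. g x * ln (g x) - g x + 1 \<partial>M) = (\<integral>x. g x * ln (g x) \<partial>M)"
    by (simp add: prob_space)
  also have "\<dots> = (\<integral>x. ln (g x) \<partial>density M g)"
    by (subst integral_density) (auto simp: nn)
  finally show "(\<integral>x. ln (g x) \<partial>density M g) = (\<integral>x. g x * ln (g x) - g x + 1 \<partial>M)" ..
qed

text \<open>For a nonnegative integrand, failure of integrability means that the integral is
  infinite, so one formula covers finite and infinite divergence. In this form Tonelli's theorem
  applies to divergences.\<close>

lemma (in prob_space) KL_density_nn_integral:
  fixes g :: "'a \<Rightarrow> real"
  assumes [measurable]: "g \<in> borel_measurable M" and nn: "\<And>x. 0 \<le> g x"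
    and prob: "prob_space (density M g)"
  shows "KL (density M g) M = (\<integral>\<^sup>+x. ennreal (g x * ln (g x) - g x + 1) \<partial>M)"
proof (cases "integrable M (\<lambda>x. g x * ln (g x) - g x + 1)")
  case True
  then show ?thesis
    using integral_ln_density[OF assms]
    by (simp add: KL_density_ln nn nn_integral_eq_integral xlnx_minus_self_plus_1_nonneg)
next
  case False
  have "(\<integral>\<^sup>+x. ennreal (g x * ln (g x) - g x + 1) \<partial>M) = \<infinity>"
  proof (rule ccontr)
    assume "(\<integral>\<^sup>+x. ennreal (g x * ln (g x) - g x + 1) \<partial>M) \<noteq> \<infinity>"
    then have "integrable M (\<lambda>x. g x * ln (g x) - g x + 1)"
      by (intro integrableI_nonneg) (auto simp: xlnx_minus_self_plus_1_nonneg nn less_top)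
    with False show False ..
  qed
  with False show ?thesis
    using integral_ln_density(1)[OF assms] by (simp add: KL_density_ln nn)
qed

lemma real_density_exists:
  assumes "prob_space M" "prob_space N" and ac: "absolutely_continuous M N" and sets: "sets N = sets M"
  obtains g :: "'a \<Rightarrow> real" where "g \<in> borel_measurable M" "\<And>x. 0 \<le> g x" "N = density M g"
    "AE x in N. 0 < g x"
proof -
  interpret M: prob_space M by fact
  interpret N: prob_space N by fact
  obtain g where g[measurable]: "g \<in> borel_measurable M"
    and RN: "AE x in M. RN_deriv M N x = ennreal (g x)" and nn: "\<And>x. 0 \<le> g x"
    and pos: "AE x in N. 0 < g x"
    using M.real_RN_deriv[OF N.finite_measure_axioms ac sets] by blast
  have "N = density M g"
    using RN by (subst M.density_RN_deriv[OF ac sets, symmetric]) (intro density_cong, auto)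
  with g nn pos show ?thesis by (intro that)
qed

text \<open>A nonnegative function with integral 0 vanishes almost everywhere, and
  \<open>t * ln t - t + 1\<close> vanishes only at \<open>t = 1\<close>. So the density is 1 almost
  everywhere.\<close>

lemma (in prob_space) KL_eq_0_imp_eq:
  assumes "prob_space N" and sets: "sets N = sets M" and 0: "KL N M = 0"
  shows "N = M"
proof -
  have ac: "absolutely_continuous M N"
    using 0 by (auto simp: KL_def split: if_splits)
  obtain g :: "'a \<Rightarrow> real" where g[measurable]: "g \<in> borel_measurable M" and nn: "\<And>x. 0 \<le> g x"
    and N: "N = density M g"
    using real_density_exists[OF prob_space_axioms assms(1) ac sets] by metis
  have "(\<integral>\<^sup>+x. ennreal (g x * ln (g x) - g x + 1) \<partial>M) = 0"
    using KL_density_nn_integral[OF g nn] 0 assms(1) unfolding N by simp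
  then have "AE x in M. ennreal (g x * ln (g x) - g x + 1) = 0"
    by (subst (asm) nn_integral_0_iff_AE) auto
  then have "AE x in M. g x = 1"
  proof eventually_elim
    case (elim x)
    then have le: "g x * ln (g x) - g x + 1 \<le> 0" by (simp add: ennreal_eq_0_iff)
    \<comment> \<open>At \<open>g x = 0\<close> the left-hand side of \<open>le\<close> would be
      1.\<close>
    then have pos: "0 < g x" using nn[of x] by (cases "g x = 0") auto
    have eq: "g x * ln (g x) = g x - 1"
      using le xlnx_minus_self_plus_1_nonneg[OF nn[of x]] by simp
    \<comment> \<open>Dividing \<open>eq\<close> by \<open>g x\<close> gives the equality case of
      \<open>ln t \<le> t - 1\<close>, which forces \<open>t = 1\<close>.\<close>
    have "ln (1 / g x) = 1 / g x - 1"
      using eq pos by (simp add: ln_div field_simps)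
    with pos have "1 / g x = 1" by (intro ln_eq_minus_one) auto
    with pos show ?case by simp
  qed
  then have "density M g = density M (\<lambda>_. 1)"
    by (intro density_cong) auto
  then show ?thesis
    unfolding N by (simp add: density_1)
qed

section \<open>A countable generator of the Borel sets\<close>

text \<open>The finite intersections of members of a countable basis work. They are still countably
  many and open, and the empty intersection supplies \<open>UNIV\<close>.\<close>

lemma borel_countable_Int_stable_generator:
  obtains G :: "'a::second_countable_topology set set"
  where "countable G" "Int_stable G" "UNIV \<in> G" "sets borel = sigma_sets UNIV G"
proof -
  obtain B :: "'a set set" where B: "countable B" "topological_basis B"
    using ex_countable_basis by auto
  define G where "G = Inter ` {F. finite F \<and> F \<subseteq> B}"
  have "countable G"
    unfolding G_def using B by (intro countable_image countable_Collect_finite_subset)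
  moreover have "Int_stable G"
  proof (rule Int_stableI)
    fix a b assume "a \<in> G" "b \<in> G"
    then obtain F F' where "finite F" "F \<subseteq> B" "a = \<Inter>F" "finite F'" "F' \<subseteq> B" "b = \<Inter>F'"
      unfolding G_def by auto
    then show "a \<inter> b \<in> G"
      unfolding G_def by (intro image_eqI[where x="F \<union> F'"]) auto
  qed
  moreover have "UNIV \<in> G"
    unfolding G_def by (intro image_eqI[where x="{}"]) auto
  moreover have "sets borel = sigma_sets UNIV G"
  proof -
    have borel: "sets borel = sigma_sets UNIV B"
      by (subst borel_eq_countable_basis[OF B]) simp
    have "sigma_sets UNIV B = sigma_sets UNIV G"
    proof (rule sigma_sets_eqI)
      fix a assume "a \<in> B"
      then have "a \<in> G" unfolding G_def by (intro image_eqI[where x="{a}"]) auto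
      then show "a \<in> sigma_sets UNIV G" by auto
    next
      fix b assume "b \<in> G"
      then obtain F where F: "finite F" "F \<subseteq> B" "b = \<Inter>F" unfolding G_def by auto
      have "open b"
        unfolding F(3) using F(1,2) B(2) by (intro open_Inter) (auto intro: topological_basis_open)
      then have "b \<in> sets borel" by simp
      then show "b \<in> sigma_sets UNIV B"
        by (simp add: borel)
    qed
    then show ?thesis
      by (simp add: borel)
  qed
  ultimately show ?thesis by (rule that)
qed

section \<open>Markov kernels: the joint law, and disintegration of densities and
  divergences\<close>

locale markov_kernel = prob_space \<pi> for \<pi> :: "'d measure" +
  fixes W :: "'w measure" and Q :: "'d \<Rightarrow> 'w measure"
  assumes Q: "Q \<in> \<pi> \<rightarrow>\<^sub>M prob_algebra W"
begin

text \<open>The weights come first, so that for \<open>W = borel\<close> this is literally the joint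
  distribution inside \<open>mutual_info (joint \<pi> borel Q) borel \<pi> snd fst\<close>.\<close>

definition law :: "('w \<times> 'd) measure" where
  "law = distr (joint \<pi> W Q) (W \<Otimes>\<^sub>M \<pi>) (\<lambda>x. (snd x, fst x))"

lemma measurable_Q[measurable]: "Q \<in> \<pi> \<rightarrow>\<^sub>M subprob_algebra W"
  by (rule measurable_prob_algebraD[OF Q])

lemma sets_Q: "D \<in> space \<pi> \<Longrightarrow> sets (Q D) = sets W"
  and prob_Q: "D \<in> space \<pi> \<Longrightarrow> prob_space (Q D)"
  using measurable_space[OF Q] by (auto simp: space_prob_algebra)

lemma sets_law: "sets law = sets (W \<Otimes>\<^sub>M \<pi>)"
  by (simp add: law_def)

text \<open>Contracting the inner bind to a push-forward leaves a single bind, the form in which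
  integrals over the joint law are computed.\<close>

lemma joint_eq: "joint \<pi> W Q = \<pi> \<bind> (\<lambda>D. distr (Q D) (\<pi> \<Otimes>\<^sub>M W) (Pair D))"
  unfolding joint_def
proof (rule bind_cong[OF refl])
  fix D assume D: "D \<in> space \<pi>"
  then show "Q D \<bind> (\<lambda>w. return (\<pi> \<Otimes>\<^sub>M W) (D, w)) = distr (Q D) (\<pi> \<Otimes>\<^sub>M W) (Pair D)"
    using prob_space.not_empty[OF prob_Q[OF D]]
    by (intro bind_return_distr') (auto simp: measurable_cong_sets[OF sets_Q[OF D] refl])
qed

lemma measurable_distr_Pair: "(\<lambda>D. distr (Q D) (\<pi> \<Otimes>\<^sub>M W) (Pair D)) \<in> \<pi> \<rightarrow>\<^sub>M prob_algebra (\<pi> \<Otimes>\<^sub>M W)"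
proof (rule measurable_prob_algebraI)
  fix D assume D: "D \<in> space \<pi>"
  interpret QD: prob_space "Q D" by (rule prob_Q[OF D])
  show "prob_space (distr (Q D) (\<pi> \<Otimes>\<^sub>M W) (Pair D))"
    using D by (intro QD.prob_space_distr) (simp add: measurable_cong_sets[OF sets_Q[OF D] refl])
qed (rule measurable_distr2[where M=W], auto)

lemma sets_joint: "sets (joint \<pi> W Q) = sets (\<pi> \<Otimes>\<^sub>M W)"
  unfolding joint_eq
  by (intro sets_bind[OF _ not_empty]) (use measurable_distr_Pair in \<open>auto dest!: measurable_space simp: space_prob_algebra\<close>)

lemma prob_space_law: "prob_space law"
proof -
  have "prob_space (joint \<pi> W Q)"
    unfolding joint_eq
    by (rule prob_space_bind'[OF _ measurable_distr_Pair])
      (simp add: space_prob_algebra prob_space_axioms)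
  then interpret joint: prob_space "joint \<pi> W Q" .
  show ?thesis
    unfolding law_def
    by (intro joint.prob_space_distr) (simp add: measurable_cong_sets[OF sets_joint refl])
qed

lemma nn_integral_law:
  assumes [measurable]: "f \<in> borel_measurable (W \<Otimes>\<^sub>M \<pi>)"
  shows "(\<integral>\<^sup>+x. f x \<partial>law) = (\<integral>\<^sup>+D. \<integral>\<^sup>+w. f (w, D) \<partial>Q D \<partial>\<pi>)"
proof -
  have "(\<integral>\<^sup>+x. f x \<partial>law) = (\<integral>\<^sup>+x. f (snd x, fst x) \<partial>joint \<pi> W Q)"
    unfolding law_def by (subst nn_integral_distr) (auto simp: measurable_cong_sets[OF sets_joint refl])
  also have "\<dots> = (\<integral>\<^sup>+D. \<integral>\<^sup>+x. f (snd x, fst x) \<partial>distr (Q D) (\<pi> \<Otimes>\<^sub>M W) (Pair D) \<partial>\<pi>)"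
    unfolding joint_eq
    by (intro nn_integral_bind[where B="\<pi> \<Otimes>\<^sub>M W"]) (auto intro: measurable_prob_algebraD measurable_distr_Pair)
  also have "\<dots> = (\<integral>\<^sup>+D. \<integral>\<^sup>+w. f (w, D) \<partial>Q D \<partial>\<pi>)"
    by (intro nn_integral_cong, subst nn_integral_distr) (auto simp: measurable_cong_sets[OF sets_Q refl])
  finally show ?thesis .
qed

lemma nn_integral_indicator_section:
  assumes A: "A \<in> sets (W \<Otimes>\<^sub>M \<pi>)" and D: "D \<in> space \<pi>"
  shows "(\<integral>\<^sup>+w. indicator A (w, D) \<partial>Q D) = emeasure (Q D) ((\<lambda>w. (w, D)) -` A)"
proof -
  have "(\<lambda>w. indicator A (w, D) :: ennreal) = indicator ((\<lambda>w. (w, D)) -` A)"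
    by (auto simp: indicator_def)
  moreover have "(\<lambda>w. (w, D)) -` A \<in> sets (Q D)"
    using sets_Pair2[OF A] sets_Q[OF D] by simp
  ultimately show ?thesis
    by simp
qed

lemma emeasure_law:
  assumes A[measurable]: "A \<in> sets (W \<Otimes>\<^sub>M \<pi>)"
  shows "emeasure law A = (\<integral>\<^sup>+D. emeasure (Q D) ((\<lambda>w. (w, D)) -` A) \<partial>\<pi>)"
proof -
  have "emeasure law A = (\<integral>\<^sup>+x. indicator A x \<partial>law)"
    by (simp add: sets_law)
  also have "\<dots> = (\<integral>\<^sup>+D. \<integral>\<^sup>+w. indicator A (w, D) \<partial>Q D \<partial>\<pi>)"
    by (rule nn_integral_law) simp
  also have "\<dots> = (\<integral>\<^sup>+D. emeasure (Q D) ((\<lambda>w. (w, D)) -` A) \<partial>\<pi>)"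
    by (intro nn_integral_cong nn_integral_indicator_section A)
  finally show ?thesis .
qed

lemma distr_law_fst: "distr law W fst = \<pi> \<bind> Q"
proof -
  have "distr law W fst = distr (joint \<pi> W Q) W snd"
    unfolding law_def by (subst distr_distr) (auto simp: measurable_cong_sets[OF sets_joint refl] comp_def)
  then show ?thesis
    using distr_joint_snd[OF prob_space_axioms Q] by simp
qed

lemma mixture_prob_algebra: "\<pi> \<bind> Q \<in> space (prob_algebra W)"
proof -
  interpret law: prob_space law by (rule prob_space_law)
  show ?thesis
    unfolding distr_law_fst[symmetric] space_prob_algebra
    by (auto intro!: law.prob_space_distr simp: measurable_cong_sets[OF sets_law refl])
qed

end

text \<open>A countable generator is what turns the countably many almost-everywhere identities
  \<open>Q D A = \<integral>\<^sub>A g(w, D) dP(w)\<close> into one identity of measures.\<close>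

lemma kernel_density_AE:
  fixes Q :: "'d \<Rightarrow> 'w::second_countable_topology measure"
  assumes "markov_kernel \<pi> borel Q" and P: "prob_space P" "sets P = sets borel"
    and g: "(g :: _ \<Rightarrow> real) \<in> borel_measurable (P \<Otimes>\<^sub>M \<pi>)"
    and J: "markov_kernel.law \<pi> borel Q = density (P \<Otimes>\<^sub>M \<pi>) g"
  shows "AE D in \<pi>. Q D = density P (\<lambda>w. g (w, D))"
proof -
  interpret markov_kernel \<pi> borel Q by fact
  interpret P: prob_space P by fact
  interpret PP: pair_prob_space P \<pi> ..
  note g[measurable]
  obtain G :: "'w set set" where G: "countable G" "Int_stable G" "UNIV \<in> G" "sets borel = sigma_sets UNIV G"
    by (rule borel_countable_Int_stable_generator)
  have spP[simp]: "space P = UNIV" using sets_eq_imp_space_eq[OF P(2)] by simp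
  have "AE D in \<pi>. emeasure (Q D) A = (\<integral>\<^sup>+w. ennreal (g (w, D)) * indicator A w \<partial>P)" if "A \<in> G" for A
  \<comment> \<open>For fixed \<open>A\<close> both sides are functions of \<open>D\<close>. Their
    integrals over any \<open>B\<close> agree, since each equals the mass that \<open>law\<close>
    gives to the rectangle \<open>A \<times> B\<close>.\<close>
  proof (rule density_unique_finite_measure)
    have [measurable]: "A \<in> sets borel" using that G by auto
    have [measurable]: "A \<in> sets P" by (simp add: P)
    show "(\<lambda>D. emeasure (Q D) A) \<in> borel_measurable \<pi>"
      by measurable
    show "(\<lambda>D. \<integral>\<^sup>+w. ennreal (g (w, D)) * indicator A w \<partial>P) \<in> borel_measurable \<pi>"
      by measurable
    fix B assume [measurable]: "B \<in> sets \<pi>"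
    have "(\<integral>\<^sup>+D. emeasure (Q D) A * indicator B D \<partial>\<pi>) =
      (\<integral>\<^sup>+D. emeasure (Q D) ((\<lambda>w. (w, D)) -` (A \<times> B)) \<partial>\<pi>)"
      by (intro nn_integral_cong) (auto simp: indicator_def)
    also have "\<dots> = emeasure law (A \<times> B)"
      by (rule emeasure_law[symmetric]) auto
    also have "\<dots> = (\<integral>\<^sup>+x. ennreal (g x) * indicator (A \<times> B) x \<partial>(P \<Otimes>\<^sub>M \<pi>))"
      unfolding J by (rule emeasure_density) auto
    also have "\<dots> = (\<integral>\<^sup>+D. \<integral>\<^sup>+w. ennreal (g (w, D)) * indicator (A \<times> B) (w, D) \<partial>P \<partial>\<pi>)"
      by (rule PP.nn_integral_snd[symmetric]) measurable
    also have "\<dots> = (\<integral>\<^sup>+D. (\<integral>\<^sup>+w. ennreal (g (w, D)) * indicator A w \<partial>P) * indicator B D \<partial>\<pi>)"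
      by (intro nn_integral_cong) (auto simp: indicator_def)
    finally show "(\<integral>\<^sup>+D. emeasure (Q D) A * indicator B D \<partial>\<pi>) = \<dots>" .
  qed auto
  then have "AE D in \<pi>. \<forall>A\<in>G. emeasure (Q D) A = (\<integral>\<^sup>+w. ennreal (g (w, D)) * indicator A w \<partial>P)"
    using G(1) by (subst AE_ball_countable) auto
  with AE_space show ?thesis
  proof eventually_elim
    case (elim D)
    have [measurable]: "(\<lambda>w. g (w, D)) \<in> borel_measurable P"
      using elim(1) by simp
    interpret QD: prob_space "Q D" by (rule prob_Q[OF elim(1)])
    show ?case
    \<comment> \<open>The exhausting family is the single set \<open>UNIV\<close>: it lies in
      \<open>G\<close> and has finite mass, as \<open>Q D\<close> is a probability measure.\<close>
    proof (rule measure_eqI_generator_eq_countable[where A="{UNIV}"])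
      fix A assume A: "A \<in> G"
      then have "A \<in> sets P" using G P by auto
      then show "emeasure (Q D) A = emeasure (density P (\<lambda>w. g (w, D))) A"
        using elim A by (simp add: emeasure_density)
    qed (use G P elim(1) in \<open>auto simp: sets_Q\<close>)
  qed
qed

text \<open>Measurability of \<open>D \<mapsto> KL (Q D) P\<close> is not available, so linearity of the integral cannot
  be used: this is why \<open>f\<close> and \<open>c\<close> are part of the statement.\<close>

lemma nn_integral_KL_kernel:
  fixes Q :: "'d \<Rightarrow> 'w::second_countable_topology measure"
  assumes "markov_kernel \<pi> borel Q" and P: "prob_space P" "sets P = sets borel"
    and f: "f \<in> borel_measurable \<pi>" and c: "0 < c"
  shows "(\<integral>\<^sup>+D. f D + c * KL (Q D) P \<partial>\<pi>)
    = (\<integral>\<^sup>+D. f D \<partial>\<pi>) + c * KL (markov_kernel.law \<pi> borel Q) (P \<Otimes>\<^sub>M \<pi>)"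
proof -
  interpret markov_kernel \<pi> borel Q by fact
  interpret P: prob_space P by fact
  interpret PP: pair_prob_space P \<pi> ..
  note f[measurable]
  have setsPP: "sets (P \<Otimes>\<^sub>M \<pi>) = sets (borel \<Otimes>\<^sub>M \<pi>)"
    by (rule sets_pair_measure_cong[OF P(2) refl])
  show ?thesis
  proof (cases "absolutely_continuous (P \<Otimes>\<^sub>M \<pi>) law")
    case True
    obtain g where g[measurable]: "(g :: _ \<Rightarrow> real) \<in> borel_measurable (P \<Otimes>\<^sub>M \<pi>)" and nn: "\<And>x. 0 \<le> g x"
      and J: "law = density (P \<Otimes>\<^sub>M \<pi>) g"
      using real_density_exists[OF PP.prob_space_axioms prob_space_law True] sets_law setsPP by metis
    \<comment> \<open>A measurable version of \<open>KL (Q D) P\<close>: it agrees with it for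
      almost every \<open>D\<close>, so the integral can be split after the replacement.\<close>
    define h where "h D = (\<integral>\<^sup>+w. ennreal (g (w, D) * ln (g (w, D)) - g (w, D) + 1) \<partial>P)" for D
    have [measurable]: "h \<in> borel_measurable \<pi>"
      unfolding h_def by measurable
    have "AE D in \<pi>. KL (Q D) P = h D"
      using kernel_density_AE[OF assms(1) P g J] AE_space
    proof eventually_elim
      case (elim D)
      have [measurable]: "(\<lambda>w. g (w, D)) \<in> borel_measurable P"
        using elim(2) by simp
      have "prob_space (density P (\<lambda>w. g (w, D)))"
        using prob_Q[OF elim(2)] elim(1) by simp
      then show ?case
        unfolding elim(1) h_def by (intro P.KL_density_nn_integral) (auto simp: nn)
    qed
    then have "(\<integral>\<^sup>+D. f D + c * KL (Q D) P \<partial>\<pi>) = (\<integral>\<^sup>+D. f D + c * h D \<partial>\<pi>)"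
      by (intro nn_integral_cong_AE) auto
    also have "\<dots> = (\<integral>\<^sup>+D. f D \<partial>\<pi>) + c * (\<integral>\<^sup>+D. h D \<partial>\<pi>)"
      by (simp add: nn_integral_add nn_integral_cmult)
    also have "(\<integral>\<^sup>+D. h D \<partial>\<pi>) = (\<integral>\<^sup>+x. ennreal (g x * ln (g x) - g x + 1) \<partial>(P \<Otimes>\<^sub>M \<pi>))"
      unfolding h_def by (rule PP.nn_integral_snd) measurable
    also have "\<dots> = KL law (P \<Otimes>\<^sub>M \<pi>)"
      unfolding J by (intro PP.KL_density_nn_integral[symmetric] g nn) (use prob_space_law in \<open>simp add: J\<close>)
    finally show ?thesis .
  next
    case False
    then obtain A where A: "A \<in> sets (P \<Otimes>\<^sub>M \<pi>)" "emeasure (P \<Otimes>\<^sub>M \<pi>) A = 0" "emeasure law A \<noteq> 0"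
      unfolding absolutely_continuous_def using sets_law setsPP by (auto simp: null_sets_def)
    \<comment> \<open>The \<open>D\<close> for which \<open>Q D\<close> charges the section of \<open>A\<close> form a measurable set of positive measure,
      and almost all of these sections are \<open>P\<close>-null.\<close>
    have A'[measurable]: "A \<in> sets (borel \<Otimes>\<^sub>M \<pi>)" using A setsPP by simp
    have meas[measurable]: "(\<lambda>D. emeasure (Q D) ((\<lambda>w. (w, D)) -` A)) \<in> borel_measurable \<pi>"
    proof -
      have "(\<lambda>D. integral\<^sup>N (Q D) (\<lambda>w. indicator A (w, D))) \<in> borel_measurable \<pi>"
        by (rule nn_integral_measurable_subprob_algebra2[OF _ measurable_Q]) measurable
      also have "?this \<longleftrightarrow> ?thesis"
        by (intro measurable_cong nn_integral_indicator_section A')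
      finally show ?thesis .
    qed
    have "(\<integral>\<^sup>+D. emeasure P ((\<lambda>w. (w, D)) -` A) \<partial>\<pi>) = 0"
      using A PP.emeasure_pair_measure_alt2[OF A(1)] by simp
    then have "AE D in \<pi>. emeasure P ((\<lambda>w. (w, D)) -` A) = 0"
      by (subst (asm) nn_integral_0_iff_AE) (use PP.measurable_emeasure_Pair2[OF A(1)] in auto)
    \<comment> \<open>The left-hand side is a measurable lower bound. It is 0 where
      \<open>Q D\<close> does not charge the section, because \<open>\<infinity> * 0 = 0\<close>,
      and infinite where it does; there absolute continuity fails and \<open>KL (Q D) P\<close> is
      infinite too.\<close>
    then have "AE D in \<pi>. \<infinity> * emeasure (Q D) ((\<lambda>w. (w, D)) -` A) \<le> f D + c * KL (Q D) P"
      using AE_space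
    proof eventually_elim
      case (elim D)
      have sA: "(\<lambda>w. (w, D)) -` A \<in> sets P"
        using sets_Pair2[OF A(1)] .
      show ?case
      proof (cases "emeasure (Q D) ((\<lambda>w. (w, D)) -` A) = 0")
        case False
        then have "\<not> absolutely_continuous P (Q D)"
          using elim sA by (auto dest: absolutely_continuousD)
        then show ?thesis
          using c by (simp add: KL_def ennreal_mult_eq_top_iff)
      qed simp
    qed
    then have "(\<integral>\<^sup>+D. \<infinity> * emeasure (Q D) ((\<lambda>w. (w, D)) -` A) \<partial>\<pi>) \<le> (\<integral>\<^sup>+D. f D + c * KL (Q D) P \<partial>\<pi>)"
      by (rule nn_integral_mono_AE)
    moreover have "(\<integral>\<^sup>+D. \<infinity> * emeasure (Q D) ((\<lambda>w. (w, D)) -` A) \<partial>\<pi>) = \<infinity> * emeasure law A"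
      by (simp only: nn_integral_cmult[OF meas] emeasure_law[OF A'])
    moreover have "\<infinity> * emeasure law A = \<infinity>"
      using A(3) by (simp add: ennreal_top_mult)
    moreover have "KL law (P \<Otimes>\<^sub>M \<pi>) = \<infinity>"
      using False by (simp add: KL_def)
    ultimately show ?thesis
      using c by (auto simp: ennreal_mult_top top_unique)
  qed
qed

section \<open>The chain rule for the divergence\<close>

text \<open>An infinite right-hand side makes the inequality trivial. Otherwise \<open>J\<close> has
  a density \<open>g\<close> and \<open>M\<close> a density \<open>m\<close>; then
  \<open>r = g / m\<close> is the density of \<open>J\<close> with respect to
  \<open>M \<Otimes>\<^sub>M \<pi>\<close>, and integrating \<open>ln g = ln r + ln m\<close> over
  \<open>J\<close> gives the claim.\<close>

lemma KL_chain_le: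
  assumes J: "prob_space J" "sets J = sets (W \<Otimes>\<^sub>M \<pi>)"
    and P: "prob_space P" "sets P = sets W" and \<pi>: "prob_space \<pi>"
  defines "M \<equiv> distr J W fst"
  shows "KL J (M \<Otimes>\<^sub>M \<pi>) + KL M P \<le> KL J (P \<Otimes>\<^sub>M \<pi>)"
proof (cases "KL J (P \<Otimes>\<^sub>M \<pi>) = \<infinity>")
  case False
  interpret J: prob_space J by fact
  interpret P: prob_space P by fact
  interpret \<pi>: prob_space \<pi> by fact
  interpret PP: pair_prob_space P \<pi> ..
  have fst[measurable]: "fst \<in> J \<rightarrow>\<^sub>M W"
    by (simp add: measurable_cong_sets[OF J(2) refl])
  interpret M: prob_space M
    unfolding M_def by (rule J.prob_space_distr[OF fst])
  interpret MP: pair_prob_space M \<pi> ..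
  have setsM: "sets M = sets P" by (simp add: M_def P)
  have setsPP: "sets J = sets (P \<Otimes>\<^sub>M \<pi>)"
    using sets_pair_measure_cong[OF P(2) refl, of \<pi>] J(2) by simp
  have acJ: "absolutely_continuous (P \<Otimes>\<^sub>M \<pi>) J"
    using False by (auto simp: KL_def split: if_splits)
  obtain g where g[measurable]: "(g :: _ \<Rightarrow> real) \<in> borel_measurable (P \<Otimes>\<^sub>M \<pi>)" and g0: "\<And>x. 0 \<le> g x"
    and Jg: "J = density (P \<Otimes>\<^sub>M \<pi>) g" and gpos: "AE x in J. 0 < g x"
    using real_density_exists[OF PP.prob_space_axioms J(1) acJ setsPP] by metis
  \<comment> \<open>A \<open>P\<close>-null set \<open>A\<close> lifts to the null cylinder
    \<open>A \<times> space \<pi>\<close>, whose mass under \<open>J\<close> is the mass of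
    \<open>A\<close> under \<open>M\<close>.\<close>
  have acM: "absolutely_continuous P M"
    unfolding absolutely_continuous_def
  proof
    fix A assume A: "A \<in> null_sets P"
    then have As: "A \<in> sets P" "emeasure P A = 0" by auto
    have "emeasure (P \<Otimes>\<^sub>M \<pi>) (A \<times> space \<pi>) = 0"
      using As by (simp add: \<pi>.emeasure_pair_measure_Times)
    then have "emeasure J (A \<times> space \<pi>) = 0"
      using As by (intro absolutely_continuousD[OF acJ]) auto
    moreover have "fst -` A \<inter> space J = A \<times> space \<pi>"
      using sets_eq_imp_space_eq[OF setsPP] sets.sets_into_space[OF As(1)]
      by (auto simp: space_pair_measure)
    ultimately have "emeasure M A = 0"
      using As unfolding M_def by (subst emeasure_distr) (auto simp: P)
    with As show "A \<in> null_sets M" by (auto simp: setsM)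
  qed
  obtain m where m[measurable]: "(m :: _ \<Rightarrow> real) \<in> borel_measurable P" and m0: "\<And>x. 0 \<le> m x"
    and Mm: "M = density P m" and mposM: "AE x in M. 0 < m x"
    using real_density_exists[OF P.prob_space_axioms M.prob_space_axioms acM setsM] by metis
  have mW[measurable]: "m \<in> borel_measurable W"
    using m by (simp add: measurable_cong_sets[OF P(2) refl])
  have mpos: "AE x in J. 0 < m (fst x)"
    using mposM unfolding M_def by (rule AE_distrD[OF fst])
  have MP: "M \<Otimes>\<^sub>M \<pi> = density (P \<Otimes>\<^sub>M \<pi>) (\<lambda>x. m (fst x))"
  proof -
    have "density P m \<Otimes>\<^sub>M density \<pi> (\<lambda>_. 1) = density (P \<Otimes>\<^sub>M \<pi>) (\<lambda>(x, y). ennreal (m x) * 1)"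
      by (rule pair_measure_density) (auto simp: density_1 \<pi>.sigma_finite_measure_axioms)
    then show ?thesis
      by (simp add: density_1 Mm case_prod_beta')
  qed
  \<comment> \<open>Where \<open>m (fst x) = 0\<close> the quotient takes the default value 0. This
    is harmless, because \<open>g\<close> vanishes there almost everywhere
    (\<open>ac0\<close>).\<close>
  define r where "r x = g x / m (fst x)" for x
  have r[measurable]: "r \<in> borel_measurable (P \<Otimes>\<^sub>M \<pi>)"
    unfolding r_def by measurable
  have rMP: "r \<in> borel_measurable (M \<Otimes>\<^sub>M \<pi>)"
    using r unfolding MP by simp
  have r0: "0 \<le> r x" for x by (simp add: r_def g0 m0)
  have ac0: "AE x in P \<Otimes>\<^sub>M \<pi>. m (fst x) = 0 \<longrightarrow> g x = 0"
    using mpos unfolding Jg by (subst (asm) AE_density) (auto elim!: eventually_mono simp: g0 less_le)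
  have Jr: "J = density (M \<Otimes>\<^sub>M \<pi>) r"
    unfolding MP r_def Jg
    by (rule density_density_divide[symmetric]) (use ac0 in \<open>auto simp: g0 m0\<close>)
  have meas_J[measurable]: "g \<in> borel_measurable J" "r \<in> borel_measurable J"
    using g r by (simp_all add: measurable_cong_sets[OF setsPP refl])
  have mJ[measurable]: "(\<lambda>x. m (fst x)) \<in> borel_measurable J"
    by measurable
  have intg: "integrable J (\<lambda>x. ln (g x))"
    using False unfolding Jg PP.KL_density_ln[OF g g0] by (auto split: if_splits)
  have negr: "integrable J (\<lambda>x. max 0 (- ln (r x)))"
    using MP.integrable_density_ln_neg[OF rMP r0] by (simp flip: Jr)
  have "integrable M (\<lambda>x. max 0 (- ln (m x)))"
    using P.integrable_density_ln_neg[OF m m0] by (simp flip: Mm)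
  then have negm: "integrable J (\<lambda>x. max 0 (- ln (m (fst x))))"
    unfolding M_def by (subst (asm) integrable_distr_eq) auto
  have lnr: "AE x in J. ln (g x) = ln (r x) + ln (m (fst x))"
    using gpos mpos by eventually_elim (simp add: r_def ln_div)
  \<comment> \<open>Negative parts of log-densities are always integrable, so integrability of the sum
    \<open>ln r + ln m\<close> gives that of both summands.\<close>
  have bound: "integrable J (\<lambda>x. \<bar>ln (g x)\<bar> + max 0 (- ln (r x)) + max 0 (- ln (m (fst x))))"
    using intg negr negm by simp
  have intr: "integrable J (\<lambda>x. ln (r x))"
    by (rule Bochner_Integration.integrable_bound[OF bound]) (use lnr in \<open>auto elim!: eventually_mono\<close>)
  have intm: "integrable J (\<lambda>x. ln (m (fst x)))"
    by (rule Bochner_Integration.integrable_bound[OF bound]) (use lnr in \<open>auto elim!: eventually_mono\<close>)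
  have intmM: "integrable M (\<lambda>x. ln (m x))"
    unfolding M_def using intm by (subst integrable_distr_eq) auto
  \<comment> \<open>\<open>ennreal\<close> truncates negative numbers, so it splits the sum in
    \<open>eq\<close> only once both summands are known to be nonnegative.\<close>
  have r_nonneg: "0 \<le> (\<integral>x. ln (r x) \<partial>J)"
    using MP.integral_ln_density(2)[OF rMP r0] intr J(1)
    by (simp add: xlnx_minus_self_plus_1_nonneg r0 flip: Jr)
  have m_nonneg: "0 \<le> (\<integral>x. ln (m x) \<partial>M)"
    using P.integral_ln_density(2)[OF m m0] intmM M.prob_space_axioms
    by (simp add: xlnx_minus_self_plus_1_nonneg m0 flip: Mm)
  have "(\<integral>x. ln (g x) \<partial>J) = (\<integral>x. ln (r x) + ln (m (fst x)) \<partial>J)"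
    by (intro integral_cong_AE lnr) measurable
  also have "\<dots> = (\<integral>x. ln (r x) \<partial>J) + (\<integral>x. ln (m (fst x)) \<partial>J)"
    by (rule Bochner_Integration.integral_add[OF intr intm])
  also have "(\<integral>x. ln (m (fst x)) \<partial>J) = (\<integral>x. ln (m x) \<partial>M)"
    unfolding M_def by (rule integral_distr[symmetric]) auto
  finally have eq: "(\<integral>x. ln (g x) \<partial>J) = (\<integral>x. ln (r x) \<partial>J) + (\<integral>x. ln (m x) \<partial>M)" .
  have "KL J (P \<Otimes>\<^sub>M \<pi>) = ennreal (\<integral>x. ln (g x) \<partial>J)"
    using PP.KL_density_ln[OF g g0] intg by (simp flip: Jg)
  moreover have "KL J (M \<Otimes>\<^sub>M \<pi>) = ennreal (\<integral>x. ln (r x) \<partial>J)"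
    using MP.KL_density_ln[OF rMP r0] intr by (simp flip: Jr)
  moreover have "KL M P = ennreal (\<integral>x. ln (m x) \<partial>M)"
    using P.KL_density_ln[OF m m0] intmM by (simp flip: Mm)
  ultimately show ?thesis
    using eq r_nonneg m_nonneg by (simp add: ennreal_plus)
qed simp

section \<open>Optimality of the mixture and the mutual information\<close>

theorem proposition5p3:
  fixes \<pi> :: "('x \<times> 'y) list measure"
    and Q :: "('x \<times> 'y) list \<Rightarrow> 'w::polish_space measure"
    and p :: "'w \<Rightarrow> 'x \<Rightarrow> 'y pmf"
    and \<beta> :: real
  assumes "prob_space \<pi>"
    and "Q \<in> \<pi> \<rightarrow>\<^sub>M prob_algebra borel"
    and "(\<lambda>(D, w). loss D (p w)) \<in> borel_measurable (\<pi> \<Otimes>\<^sub>M borel)"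
    and "\<beta> > 0"
  shows "is_arg_min (expected_complexity p \<beta> \<pi> Q) (\<lambda>P. P \<in> space (prob_algebra borel)) (\<pi> \<bind> Q)
    \<and> (expected_complexity p \<beta> \<pi> Q (\<pi> \<bind> Q) < \<infinity> \<longrightarrow>
        (\<forall>P. is_arg_min (expected_complexity p \<beta> \<pi> Q) (\<lambda>P. P \<in> space (prob_algebra borel)) P
          \<longrightarrow> P = \<pi> \<bind> Q))
    \<and> (\<integral>\<^sup>+ D. info_in_weights D (\<pi> \<bind> Q) Q \<partial>\<pi>) = mutual_info (joint \<pi> borel Q) borel \<pi> snd fst"
proof -
  interpret markov_kernel \<pi> borel Q
    using assms(1,2) by (simp add: markov_kernel_def markov_kernel_axioms_def)
  let ?M = "\<pi> \<bind> Q"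
  let ?E = "expected_complexity p \<beta> \<pi> Q"
  \<comment> \<open>The expected loss, possibly infinite, does not involve \<open>P\<close>; only
    the divergence term varies in the minimization.\<close>
  define L where "L = (\<integral>\<^sup>+D. \<integral>\<^sup>+w. loss D (p w) \<partial>Q D \<partial>\<pi>)"
  have Lmeas: "(\<lambda>D. \<integral>\<^sup>+w. loss D (p w) \<partial>Q D) \<in> borel_measurable \<pi>"
    by (rule nn_integral_measurable_subprob_algebra2[OF assms(3) measurable_Q])
  have E: "?E P = L + ennreal \<beta> * KL law (P \<Otimes>\<^sub>M \<pi>)" if "P \<in> space (prob_algebra borel)" for P
    unfolding expected_complexity_def complexity_def info_in_weights_def L_def
    using that assms(4)
    by (intro nn_integral_KL_kernel markov_kernel_axioms Lmeas) (auto simp: space_prob_algebra)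
  have M: "?M \<in> space (prob_algebra borel)" by (rule mixture_prob_algebra)
  have chain: "KL law (?M \<Otimes>\<^sub>M \<pi>) + KL ?M P \<le> KL law (P \<Otimes>\<^sub>M \<pi>)" if "P \<in> space (prob_algebra borel)" for P
    unfolding distr_law_fst[symmetric] using that
    by (intro KL_chain_le prob_space_law sets_law prob_space_axioms) (auto simp: space_prob_algebra)
  \<comment> \<open>The excess over the value at the mixture is bounded below by a divergence: its
    nonnegativity gives minimality, its vanishing gives uniqueness.\<close>
  have min: "?E ?M + ennreal \<beta> * KL ?M P \<le> ?E P" if P: "P \<in> space (prob_algebra borel)" for P
    using mult_left_mono[OF chain[OF P], of "ennreal \<beta>"]
    unfolding E[OF P] E[OF M] by (simp add: distrib_left add.assoc add_left_mono)
  have "is_arg_min ?E (\<lambda>P. P \<in> space (prob_algebra borel)) ?M"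
    unfolding is_arg_min_def
  proof (intro conjI M notI)
    assume "\<exists>P. P \<in> space (prob_algebra borel) \<and> ?E P < ?E ?M"
    then obtain P where P: "P \<in> space (prob_algebra borel)" "?E P < ?E ?M" by auto
    have "?E ?M \<le> ?E ?M + ennreal \<beta> * KL ?M P" by simp
    also have "\<dots> \<le> ?E P" by (rule min[OF P(1)])
    finally show False using P(2) by simp
  qed
  moreover have "P = ?M"
    if fin: "?E ?M < \<infinity>" and arg: "is_arg_min ?E (\<lambda>P. P \<in> space (prob_algebra borel)) P" for P
  proof -
    have P: "P \<in> space (prob_algebra borel)" and le: "?E P \<le> ?E ?M"
      using arg M by (auto simp: is_arg_min_def not_less)
    interpret P: prob_space P using P by (simp add: space_prob_algebra)
    have "?E ?M + ennreal \<beta> * KL ?M P \<le> ?E ?M + 0"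
      using order_trans[OF min[OF P] le] by simp
    then have "ennreal \<beta> * KL ?M P = 0"
      \<comment> \<open>Finiteness of the minimum is what permits cancellation in the extended
        reals.\<close>
      using fin by (subst (asm) ennreal_add_left_cancel_le) auto
    then have "KL ?M P = 0"
      using assms(4) by simp
    then have "?M = P"
      using M P by (intro P.KL_eq_0_imp_eq) (auto simp: space_prob_algebra)
    then show ?thesis ..
  qed
  moreover have "(\<integral>\<^sup>+ D. info_in_weights D ?M Q \<partial>\<pi>) = mutual_info (joint \<pi> borel Q) borel \<pi> snd fst"
  proof -
    \<comment> \<open>The choice \<open>f = 0\<close>, \<open>c = 1\<close> isolates the information
      term. The marginals of the joint law are \<open>\<pi>\<close> and \<open>?M\<close>, so the
      right-hand side is the mutual information.\<close>
    have "(\<integral>\<^sup>+D. 0 + 1 * KL (Q D) ?M \<partial>\<pi>) = (\<integral>\<^sup>+D. 0 \<partial>\<pi>) + 1 * KL law (?M \<Otimes>\<^sub>M \<pi>)"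
      using M by (intro nn_integral_KL_kernel markov_kernel_axioms) (auto simp: space_prob_algebra)
    then show ?thesis
      by (simp add: info_in_weights_def mutual_info_def law_def
          distr_joint_fst[OF assms(1,2)] distr_joint_snd[OF assms(1,2)])
  qed
  ultimately show ?thesis by blast
qed

end
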